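(* For any $d\geq 2$ and any $n_1\geq\cdots\geq n_d\geq 1$ it holds \[\mathrm{qc}(n_1, n_2, \dots, n_d) \in O \left( \prod_{i = 2}^{d} n_i \left( \log_2 \frac{n_1}{n_{2}} + 1 \right) \right).\]
   Context: Search game on the grid $S_1\times\cdots\times S_d$ with $S_i=\{0,\ldots,n_i-1\}$: Adversary fixes a target $t$; Algorithm queries a point $q$; if $q\neq t$, Adversary answers for every coordinate $i$ one of $t_i<q_i$ or $t_i>q_i$, at least one of these $d$ inequalities being true, and Algorithm does not learn which one. $\mathrm{qc}(n_1,\ldots,n_d)$ denotes the minimum number of queries that guarantees finding the target (the query complexity). *)

theory Defs
  imports Complex_Main "HOL-Library.FuncSet" "HOL-Library.Landau_Symbols"
begin

type_synonym point = "nat \<Rightarrow> nat"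

definition grid :: "nat \<Rightarrow> (nat \<Rightarrow> nat) \<Rightarrow> point set" where
  "grid d n = (\<Pi>\<^sub>E i\<in>{1..d}. {0..<n i})"

text \<open>An answer claims, for each coordinate \<open>i\<close>, either \<open>t i < q i\<close> (\<open>Below\<close>) or \<open>t i > q i\<close>
  (\<open>Above\<close>). Its values outside \<open>{1..d}\<close> carry no claim.\<close>

datatype side = Below | Above

type_synonym answer = "nat \<Rightarrow> side"

fun claim_holds :: "side \<Rightarrow> nat \<Rightarrow> nat \<Rightarrow> bool" where
  "claim_holds Below t q \<longleftrightarrow> t < q"
| "claim_holds Above t q \<longleftrightarrow> t > q"

definition admissible :: "nat \<Rightarrow> point \<Rightarrow> point \<Rightarrow> answer \<Rightarrow> bool" where
  "admissible d t q a \<longleftrightarrow> (\<exists>i\<in>{1..d}. claim_holds (a i) (t i) (q i))"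

text \<open>A strategy of Algorithm determines the next query from the answers received so far; its own
  earlier queries are determined by these answers.\<close>

type_synonym strategy = "answer list \<Rightarrow> point"

definition is_strategy :: "nat \<Rightarrow> (nat \<Rightarrow> nat) \<Rightarrow> strategy \<Rightarrow> bool" where
  "is_strategy d n \<sigma> \<longleftrightarrow> (\<forall>h. \<sigma> h \<in> grid d n)"

definition query :: "strategy \<Rightarrow> (nat \<Rightarrow> answer) \<Rightarrow> nat \<Rightarrow> point" where
  "query \<sigma> a k = \<sigma> (map a [0..<k])"

text \<open>Whatever the target and the answers, the target is among the first \<open>m\<close> queries. Since \<open>a\<close>
  is arbitrary, Adversary may answer adaptively; answers from the query hitting the target onwards
  are irrelevant.\<close>

definition finds_within :: "nat \<Rightarrow> (nat \<Rightarrow> nat) \<Rightarrow> strategy \<Rightarrow> nat \<Rightarrow> bool" where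
  "finds_within d n \<sigma> m \<longleftrightarrow>
     (\<forall>t\<in>grid d n. \<forall>a. (\<forall>k<m. query \<sigma> a k \<noteq> t \<longrightarrow> admissible d t (query \<sigma> a k) (a k)) \<longrightarrow>
        (\<exists>k<m. query \<sigma> a k = t))"

definition qc :: "nat \<Rightarrow> (nat \<Rightarrow> nat) \<Rightarrow> nat" where
  "qc d n = (LEAST m. \<exists>\<sigma>. is_strategy d n \<sigma> \<and> finds_within d n \<sigma> m)"

text \<open>Querying all grid points one by one shows that the minimum in \<^const>\<open>qc\<close> is attained.\<close>

lemma qc_attained:
  assumes "\<And>i. i \<in> {1..d} \<Longrightarrow> n i \<ge> 1"
  shows "\<exists>\<sigma>. is_strategy d n \<sigma> \<and> finds_within d n \<sigma> (qc d n)"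
proof -
  have "finite (grid d n)"
    unfolding grid_def by (intro finite_PiE) auto
  then obtain xs where xs: "set xs = grid d n"
    using finite_list by blast
  have "grid d n \<noteq> {}"
    using assms unfolding grid_def by (force simp: PiE_eq_empty_iff)
  then have ne: "xs \<noteq> []"
    using xs by auto
  define \<sigma> :: strategy where "\<sigma> h = xs ! (length h mod length xs)" for h
  have "is_strategy d n \<sigma>"
    using ne xs unfolding is_strategy_def \<sigma>_def by (metis length_greater_0_conv mod_less_divisor nth_mem)
  moreover have "finds_within d n \<sigma> (length xs)"
    unfolding finds_within_def query_def \<sigma>_def
    using xs by (metis in_set_conv_nth length_map length_upt minus_nat.diff_0 mod_less)
  ultimately show ?thesis
    unfolding qc_def by (rule_tac LeastI[where k = "length xs"]) blast
qed

end

theory Submission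
  imports Defs "HOL-Library.Log_Nat" "HOL-Analysis.Convex"
begin

text \<open>
  For a target that agrees with the query in the coordinates \<open>i \<ge> 3\<close>, one of the claims about the
  first two coordinates is true. So it suffices to search a rectangle of height \<open>n 1\<close> and width
  \<open>n 2\<close>, separately for each choice of the other coordinates.

  In a rectangle of height \<open>L\<close>, perform a binary search for the first coordinate in the middle
  column. Each answer excludes a closed quadrant, so it cuts the middle column and also the part
  on the left of it or the part on the right of it. Once the column is exhausted, no row meets both
  remaining parts, so their heights sum up to at most \<open>L\<close>. Recursing into the two parts, the
  concavity of the logarithm bounds the number of queries at depth \<open>j\<close>, for a rectangle of width
  below \<open>2 ^ k\<close>, by \<open>2 ^ j * (1 + (k - j) + log 2 (1 + L / 2 ^ k))\<close>; the sum over \<open>j < k\<close> is of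
  order \<open>2 ^ k * (1 + log 2 (1 + L / 2 ^ k))\<close>.
\<close>

section \<open>Searchable target sets\<close>

definition remaining :: "nat \<Rightarrow> point \<Rightarrow> answer \<Rightarrow> point set \<Rightarrow> point set" where
  "remaining d q a A = {t \<in> A. t \<noteq> q \<and> admissible d t q a}"

text \<open>The budget \<open>c\<close> for the queries is real, which avoids rounding in the later estimates.\<close>

inductive searchable :: "nat \<Rightarrow> (nat \<Rightarrow> nat) \<Rightarrow> real \<Rightarrow> point set \<Rightarrow> bool" for d n where
  empty: "0 \<le> c \<Longrightarrow> searchable d n c {}"
| query: "q \<in> grid d n \<Longrightarrow> (\<And>a. searchable d n c (remaining d q a A)) \<Longrightarrow> searchable d n (c + 1) A"

lemma searchable_nonneg: "searchable d n c A \<Longrightarrow> 0 \<le> c"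
  by (induction rule: searchable.induct) auto

lemma searchable_mono:
  assumes "searchable d n c A" "B \<subseteq> A" "c \<le> c'"
  shows "searchable d n c' B"
  using assms
proof (induction arbitrary: B c' rule: searchable.induct)
  case (empty c)
  then show ?case by (auto intro: searchable.empty)
next
  case (query q c A)
  have "searchable d n (c' - 1) (remaining d q a B)" for a
    by (rule query.IH) (use query.prems in \<open>auto simp: remaining_def\<close>)
  from searchable.query[OF query.hyps(1) this] show ?case by simp
qed

lemma searchable_Un:
  assumes "searchable d n c A" "searchable d n c' B"
  shows "searchable d n (c + c') (A \<union> B)"
  using assms(1)
proof (induction rule: searchable.induct)
  case (empty c)
  then show ?case using assms(2) by (auto intro: searchable_mono)
next
  case (query q c A)
  have "searchable d n (c + c') (remaining d q a (A \<union> B))" for a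
    by (rule searchable_mono[OF query.IH[of a]]) (auto simp: remaining_def)
  from searchable.query[OF query.hyps(1) this] show ?case by (simp add: algebra_simps)
qed

lemma searchable_UN:
  assumes "finite P" "\<And>p. p \<in> P \<Longrightarrow> searchable d n (c p) (A p)"
  shows "searchable d n (\<Sum>p\<in>P. c p) (\<Union>p\<in>P. A p)"
  using assms by (induction rule: finite_induct) (auto intro: searchable.empty searchable_Un)

definition finds_among :: "nat \<Rightarrow> strategy \<Rightarrow> nat \<Rightarrow> point set \<Rightarrow> bool" where
  "finds_among d \<sigma> m A \<longleftrightarrow>
     (\<forall>t\<in>A. \<forall>a. (\<forall>k<m. query \<sigma> a k \<noteq> t \<longrightarrow> admissible d t (query \<sigma> a k) (a k)) \<longrightarrow>
        (\<exists>k<m. query \<sigma> a k = t))"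

fun query_first :: "point \<Rightarrow> (answer \<Rightarrow> strategy) \<Rightarrow> strategy" where
  "query_first q \<tau> [] = q"
| "query_first q \<tau> (b # h) = \<tau> b h"

lemma query_query_first_0: "query (query_first q \<tau>) a 0 = q"
  by (simp add: query_def)

lemma query_query_first_Suc:
  "query (query_first q \<tau>) a (Suc k) = query (\<tau> (a 0)) (\<lambda>i. a (Suc i)) k"
  by (simp add: query_def map_upt_Suc del: upt_Suc)

lemma is_strategy_query_first:
  "q \<in> grid d n \<Longrightarrow> (\<And>b. is_strategy d n (\<tau> b)) \<Longrightarrow> is_strategy d n (query_first q \<tau>)"
  unfolding is_strategy_def by (metis query_first.elims)

lemma finds_among_query_first:
  assumes "\<And>b. finds_among d (\<tau> b) m (remaining d q b A)"
  shows "finds_among d (query_first q \<tau>) (Suc m) A"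
  unfolding finds_among_def
proof (intro ballI allI impI)
  fix t a
  let ?\<sigma> = "query_first q \<tau>"
  assume "t \<in> A"
    and admissible: "\<forall>k<Suc m. query ?\<sigma> a k \<noteq> t \<longrightarrow> admissible d t (query ?\<sigma> a k) (a k)"
  show "\<exists>k<Suc m. query ?\<sigma> a k = t"
  proof (cases "t = q")
    case True
    then show ?thesis using query_query_first_0 by auto
  next
    case False
    then have "t \<in> remaining d q (a 0) A"
      using admissible[rule_format, of 0] \<open>t \<in> A\<close> by (simp add: remaining_def query_query_first_0)
    moreover have "\<forall>k<m. query (\<tau> (a 0)) (\<lambda>i. a (Suc i)) k \<noteq> t \<longrightarrow>
        admissible d t (query (\<tau> (a 0)) (\<lambda>i. a (Suc i)) k) (a (Suc k))"
      using admissible[rule_format, of "Suc k" for k] by (simp add: query_query_first_Suc)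
    ultimately obtain k where "k < m" "query (\<tau> (a 0)) (\<lambda>i. a (Suc i)) k = t"
      using assms[of "a 0", unfolded finds_among_def, rule_format, of t "\<lambda>i. a (Suc i)"] by blast
    then show ?thesis
      by (intro exI[of _ "Suc k"]) (simp add: query_query_first_Suc)
  qed
qed

lemma searchable_imp_strategy:
  assumes "searchable d n c A" "grid d n \<noteq> {}"
  shows "\<exists>\<sigma>. is_strategy d n \<sigma> \<and> finds_among d \<sigma> (nat \<lfloor>c\<rfloor>) A"
  using assms(1)
proof (induction rule: searchable.induct)
  case (empty c)
  obtain g where "g \<in> grid d n" using assms(2) by auto
  then show ?case by (intro exI[of _ "\<lambda>_. g"]) (simp add: is_strategy_def finds_among_def)
next
  case (query q c A)
  have "\<exists>\<tau>. \<forall>b. is_strategy d n (\<tau> b) \<and>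
      finds_among d (\<tau> b) (nat \<lfloor>c\<rfloor>) (remaining d q b A)"
    by (rule choice) (use query.IH in blast)
  then obtain \<tau> where \<tau>: "\<And>b. is_strategy d n (\<tau> b)"
      "\<And>b. finds_among d (\<tau> b) (nat \<lfloor>c\<rfloor>) (remaining d q b A)"
    by blast
  have "nat \<lfloor>c + 1\<rfloor> = Suc (nat \<lfloor>c\<rfloor>)"
    using searchable_nonneg[OF query.hyps(2)] by (simp add: nat_add_distrib)
  then have "finds_among d (query_first q \<tau>) (nat \<lfloor>c + 1\<rfloor>) A"
    using finds_among_query_first[OF \<tau>(2)] by simp
  moreover have "is_strategy d n (query_first q \<tau>)"
    by (rule is_strategy_query_first[OF query.hyps(1) \<tau>(1)])
  ultimately show ?case by blast
qed

lemma qc_le_of_searchable: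
  assumes "searchable d n c (grid d n)" "grid d n \<noteq> {}"
  shows "real (qc d n) \<le> c"
proof -
  have "\<exists>\<sigma>. is_strategy d n \<sigma> \<and> finds_within d n \<sigma> (nat \<lfloor>c\<rfloor>)"
    using searchable_imp_strategy[OF assms] by (simp only: finds_within_def finds_among_def)
  then have "qc d n \<le> nat \<lfloor>c\<rfloor>"
    unfolding qc_def by (rule Least_le)
  then show ?thesis using searchable_nonneg[OF assms(1)] by linarith
qed

section \<open>Two-dimensional slices\<close>

definition slice :: "point \<Rightarrow> (nat \<times> nat) set \<Rightarrow> point set" where
  "slice p R = (\<lambda>(y, x). p(1 := y, 2 := x)) ` R"

lemma slice_mono: "R \<subseteq> R' \<Longrightarrow> slice p R \<subseteq> slice p R'"
  unfolding slice_def by (rule image_mono)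

lemma slice_Un: "slice p (R \<union> R') = slice p R \<union> slice p R'"
  by (simp add: slice_def image_Un)

lemma slice_empty: "slice p {} = {}"
  by (simp add: slice_def)

lemma grid_eq_UN_slice:
  assumes "2 \<le> d"
  shows "grid d n = (\<Union>p\<in>\<Pi>\<^sub>E i\<in>{3..d}. {0..<n i}. slice p ({..<n 1} \<times> {..<n 2}))"
proof -
  have coordinates: "{1..d} = insert 1 (insert 2 {3..d})"
    using assms by auto
  show ?thesis
  proof (intro equalityI subsetI)
    fix t assume t_in_grid: "t \<in> grid d n"
    let ?p = "restrict t {3..d}"
    have "t = ?p(1 := t 1, 2 := t 2)"
      using t_in_grid unfolding grid_def coordinates by (auto simp: PiE_iff extensional_def fun_eq_iff)
    then have "t \<in> slice ?p ({..<n 1} \<times> {..<n 2})"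
      using t_in_grid unfolding grid_def slice_def coordinates by (intro image_eqI[of _ _ "(t 1, t 2)"]) auto
    moreover have "?p \<in> (\<Pi>\<^sub>E i\<in>{3..d}. {0..<n i})"
      using t_in_grid unfolding grid_def coordinates by auto
    ultimately show "t \<in> (\<Union>p\<in>\<Pi>\<^sub>E i\<in>{3..d}. {0..<n i}. slice p ({..<n 1} \<times> {..<n 2}))" by blast
  next
    fix t assume "t \<in> (\<Union>p\<in>\<Pi>\<^sub>E i\<in>{3..d}. {0..<n i}. slice p ({..<n 1} \<times> {..<n 2}))"
    then show "t \<in> grid d n"
      unfolding grid_def slice_def coordinates by (auto simp: PiE_iff extensional_def)
  qed
qed

lemma not_claim_holds_refl: "\<not> claim_holds s x x"
  by (cases s) auto

lemma remaining_slice_subset: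
  "remaining d (p(1 := y, 2 := x)) a (slice p R)
     \<subseteq> slice p {(y', x') \<in> R. claim_holds (a 1) y' y \<or> claim_holds (a 2) x' x}"
proof
  fix t assume t_remaining: "t \<in> remaining d (p(1 := y, 2 := x)) a (slice p R)"
  then obtain y' x' where t_eq: "(y', x') \<in> R" "t = p(1 := y', 2 := x')"
    by (auto simp: remaining_def slice_def)
  obtain i where claim: "claim_holds (a i) (t i) ((p(1 := y, 2 := x)) i)"
    using t_remaining by (auto simp: remaining_def admissible_def)
  then have "i = 1 \<or> i = 2"
    using not_claim_holds_refl t_eq(2) by (metis fun_upd_other)
  with claim t_eq(2) have "claim_holds (a 1) y' y \<or> claim_holds (a 2) x' x"
    by auto
  then show "t \<in> slice p {(y', x') \<in> R. claim_holds (a 1) y' y \<or> claim_holds (a 2) x' x}"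
    unfolding slice_def using t_eq by (intro image_eqI[of _ _ "(y', x')"]) auto
qed

lemma searchable_slice_query:
  assumes "p(1 := y, 2 := x) \<in> grid d n"
    and "\<And>s s'. searchable d n c (slice p {(y', x') \<in> R. claim_holds s y' y \<or> claim_holds s' x' x})"
  shows "searchable d n (c + 1) (slice p R)"
proof (rule searchable.query[OF assms(1)])
  show "searchable d n c (remaining d (p(1 := y, 2 := x)) a (slice p R))" for a
    by (rule searchable_mono[OF assms(2) remaining_slice_subset order_refl])
qed

section \<open>Binary search in a column\<close>

lemma card_less_enumerate:
  fixes S :: "'a::wellorder set"
  assumes "finite S" "k < card S"
  shows "card (S \<inter> {..<enumerate S k}) = k"
proof -
  have "S \<inter> {..<enumerate S k} = enumerate S ` {..<k}"
  proof (intro equalityI subsetI)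
    fix z assume z_below: "z \<in> S \<inter> {..<enumerate S k}"
    then obtain i where "i < card S" "z = enumerate S i"
      using finite_enumerate_Ex[OF assms(1)] by blast
    with z_below show "z \<in> enumerate S ` {..<k}"
      using assms by auto
  qed (use assms in \<open>auto intro: finite_enumerate_in_set finite_enumerate_mono\<close>)
  moreover have "inj_on (enumerate S) {..<k}"
    using finite_bij_enumerate[OF assms(1)] assms(2) by (auto simp: bij_betw_def elim: inj_on_subset)
  ultimately show ?thesis by (simp add: card_image)
qed

lemma ex_median:
  fixes S :: "'a::wellorder set"
  assumes "finite S" "S \<noteq> {}"
  obtains m where "m \<in> S" "card (S \<inter> {..<m}) \<le> card S div 2" "card (S \<inter> {m<..}) \<le> card S div 2"
proof -
  define m where "m = enumerate S (card S div 2)"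
  have "card S div 2 < card S"
    using assms by (simp add: card_gt_0_iff)
  then have m_in: "m \<in> S" and below: "card (S \<inter> {..<m}) = card S div 2"
    unfolding m_def using assms(1) by (auto simp: card_less_enumerate intro: finite_enumerate_in_set)
  have "S \<inter> {m<..} = S - insert m (S \<inter> {..<m})"
    by auto
  then have "card (S \<inter> {m<..}) = card S - Suc (card S div 2)"
    using m_in below assms(1) by (simp add: card_Diff_subset)
  with m_in below show thesis
    by (intro that[of m]) linarith+
qed

definition claimed :: "side \<Rightarrow> nat \<Rightarrow> nat set" where
  "claimed s y = {z. claim_holds s z y}"

lemma claimed_simps: "claimed Below y = {..<y}" "claimed Above y = {y<..}"
  by (auto simp: claimed_def)

text \<open>The targets that are left during the search of column \<open>x\<close>: the rows \<open>I\<close> of the part \<open>A\<close> on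
  the left of the column, the rows \<open>J\<close> of the part \<open>B\<close> on the right of it, and the rows of the
  column itself that are in both.\<close>

definition column_region ::
  "nat \<Rightarrow> nat set \<Rightarrow> nat set \<Rightarrow> nat set \<Rightarrow> nat set \<Rightarrow> (nat \<times> nat) set" where
  "column_region x A B I J = I \<times> A \<union> J \<times> B \<union> (I \<inter> J) \<times> {x}"

lemma column_region_claim_subset:
  assumes "A \<subseteq> {..<x}" "B \<subseteq> {x<..}"
  shows "{(y', x') \<in> column_region x A B I J. claim_holds s y' y \<or> claim_holds s' x' x}
    \<subseteq> (case s' of Below \<Rightarrow> column_region x A B I (J \<inter> claimed s y)
         | Above \<Rightarrow> column_region x A B (I \<inter> claimed s y) J)"
  using assms by (cases s') (auto simp: column_region_def claimed_def)

lemma searchable_column_query: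
  assumes "A \<subseteq> {..<x}" "B \<subseteq> {x<..}" "p(1 := y, 2 := x) \<in> grid d n"
    and left: "\<And>s. searchable d n c (slice p (column_region x A B (I \<inter> claimed s y) J))"
    and right: "\<And>s. searchable d n c (slice p (column_region x A B I (J \<inter> claimed s y)))"
  shows "searchable d n (c + 1) (slice p (column_region x A B I J))"
proof (rule searchable_slice_query[OF assms(3)])
  fix s s'
  have "searchable d n c (slice p (case s' of Below \<Rightarrow> column_region x A B I (J \<inter> claimed s y)
      | Above \<Rightarrow> column_region x A B (I \<inter> claimed s y) J))"
    using left right by (cases s') auto
  then show "searchable d n c
      (slice p {(y', x') \<in> column_region x A B I J. claim_holds s y' y \<or> claim_holds s' x' x})"
    by (rule searchable_mono[OF _ slice_mono[OF column_region_claim_subset[OF assms(1,2)]] order_refl])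
qed

lemma searchable_column:
  assumes "finite Y" and column: "slice p (Y \<times> {x}) \<subseteq> grid d n"
    and sides: "A \<subseteq> {..<x}" "B \<subseteq> {x<..}"
    and disjoint: "\<And>I J. I \<subseteq> Y \<Longrightarrow> J \<subseteq> Y \<Longrightarrow> I \<inter> J = {} \<Longrightarrow>
      searchable d n c (slice p (I \<times> A \<union> J \<times> B))"
    and "I \<subseteq> Y" "J \<subseteq> Y" "card (I \<inter> J) < 2 ^ r"
  shows "searchable d n (r + c) (slice p (column_region x A B I J))"
  using \<open>I \<subseteq> Y\<close> \<open>J \<subseteq> Y\<close> \<open>card (I \<inter> J) < 2 ^ r\<close>
proof (induction r arbitrary: I J)
  case 0
  then have "I \<inter> J = {}"
    using finite_subset[OF _ \<open>finite Y\<close>] by auto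
  then show ?case using disjoint 0 by (simp add: column_region_def)
next
  case (Suc r)
  have finite_Int: "finite (I \<inter> J)"
    using Suc.prems(1) \<open>finite Y\<close> by (auto intro: finite_subset)
  show ?case
  proof (cases "I \<inter> J = {}")
    case True
    then have "searchable d n c (slice p (column_region x A B I J))"
      using disjoint Suc.prems by (simp add: column_region_def)
    then show ?thesis by (rule searchable_mono) auto
  next
    case False
    obtain y where median: "y \<in> I \<inter> J" "card (I \<inter> J \<inter> {..<y}) \<le> card (I \<inter> J) div 2"
        "card (I \<inter> J \<inter> {y<..}) \<le> card (I \<inter> J) div 2"
      using ex_median[OF finite_Int False] .
    have halved: "card (I \<inter> J \<inter> claimed s y) < 2 ^ r" for s
      using median(2,3) Suc.prems(3) by (cases s) (auto simp: claimed_simps)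
    have "searchable d n (r + c + 1) (slice p (column_region x A B I J))"
    proof (rule searchable_column_query[OF sides])
      show "p(1 := y, 2 := x) \<in> grid d n"
        using column median(1) Suc.prems(1) by (auto simp: slice_def)
      show "searchable d n (r + c) (slice p (column_region x A B (I \<inter> claimed s y) J))" for s
        using Suc.prems halved[of s] by (intro Suc.IH) (auto simp: Int_ac)
      show "searchable d n (r + c) (slice p (column_region x A B I (J \<inter> claimed s y)))" for s
        using Suc.prems halved[of s] by (intro Suc.IH) (auto simp: Int_ac)
    qed
    then show ?thesis by (simp add: algebra_simps)
  qed
qed

section \<open>Cost of searching a rectangle\<close>

lemma log_add_le_log_mean:
  fixes b x y :: real
  assumes "1 < b" "0 < x" "0 < y"
  shows "log b x + log b y \<le> 2 * log b ((x + y) / 2)"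
  using concave_onD[OF log_concave[OF assms(1)], of "1 / 2" x y] assms
  by (simp add: field_simps)

lemma log_one_plus_le:
  fixes b x :: real
  assumes "1 < b" "0 \<le> x"
  shows "log b (1 + x) \<le> k + log b (1 + x / b ^ k)"
proof -
  have pos: "0 < 1 + x / b ^ k"
    using assms by (intro add_pos_nonneg) auto
  have "1 + x \<le> b ^ k * (1 + x / b ^ k)"
    using assms by (simp add: distrib_left)
  then have "log b (1 + x) \<le> log b (b ^ k * (1 + x / b ^ k))"
    using assms by (intro log_mono) auto
  also have "\<dots> = k + log b (1 + x / b ^ k)"
    using pos assms(1) by (subst log_mult) (auto simp: log_nat_power)
  finally show ?thesis .
qed

lemma log_one_plus_nonneg:
  fixes b x :: real
  shows "1 < b \<Longrightarrow> 0 \<le> x \<Longrightarrow> 0 \<le> log b (1 + x)"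
  by (subst zero_le_log_cancel_iff) auto

lemma floorlog_le_log_one_plus:
  assumes "1 < b"
  shows "real (floorlog b m) \<le> 1 + log b (1 + real m)"
proof (cases "m = 0")
  case False
  then have "real (floorlog b m) \<le> 1 + log b (real m)"
    using assms by (simp add: floorlog_def)
  also have "log b (real m) \<le> log b (1 + real m)"
    using False assms by simp
  finally show ?thesis by simp
qed (simp add: floorlog_def)

text \<open>This is \<open>\<Sum>j<k. 2 ^ j * (1 + (k - j) + log 2 (1 + L / 2 ^ k))\<close> in closed form.\<close>

definition bisection_cost :: "nat \<Rightarrow> nat \<Rightarrow> real" where
  "bisection_cost k L = (2 ^ k - 1) * (3 + log 2 (1 + L / 2 ^ k)) - k"

lemma bisection_cost_nonneg: "0 \<le> bisection_cost k L"
proof -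
  have "real (Suc k) \<le> 2 ^ k"
    by (metis Suc_leI less_exp of_nat_le_iff of_nat_numeral of_nat_power)
  then have "real k \<le> (2 ^ k - 1) * 3" by simp
  also have "\<dots> \<le> (2 ^ k - 1) * (3 + log 2 (1 + L / 2 ^ k))"
    by (intro mult_left_mono) (simp_all add: log_one_plus_nonneg)
  finally show ?thesis by (simp add: bisection_cost_def)
qed

lemma bisection_cost_split:
  assumes "i + j \<le> L"
  shows "bisection_cost k i + bisection_cost k j + (1 + log 2 (1 + real L)) \<le> bisection_cost (Suc k) L"
proof -
  define g where "g = log 2 (1 + L / 2 ^ Suc k)"
  have "log 2 (1 + i / 2 ^ k) + log 2 (1 + j / 2 ^ k)
      \<le> 2 * log 2 (((1 + i / 2 ^ k) + (1 + j / 2 ^ k)) / 2)"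
    by (rule log_add_le_log_mean) (auto intro: add_pos_nonneg)
  also have "((1 + i / 2 ^ k) + (1 + j / 2 ^ k)) / 2 = 1 + real (i + j) / 2 ^ Suc k"
    by (simp add: add_divide_distrib)
  also have "2 * log 2 (1 + real (i + j) / 2 ^ Suc k) \<le> 2 * g"
    unfolding g_def using assms
    by (intro mult_left_mono log_mono add_left_mono divide_right_mono) (auto intro: add_pos_nonneg)
  finally have "(2 ^ k - 1) * (log 2 (1 + i / 2 ^ k) + log 2 (1 + j / 2 ^ k)) \<le> (2 ^ k - 1) * (2 * g)"
    by (intro mult_left_mono) auto
  moreover have "log 2 (1 + real L) \<le> Suc k + g"
    unfolding g_def by (rule log_one_plus_le) auto
  ultimately show ?thesis
    unfolding bisection_cost_def g_def[symmetric] by (simp add: algebra_simps)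
qed

lemma searchable_disjoint_rows:
  assumes "finite Y" "I \<subseteq> Y" "J \<subseteq> Y" "I \<inter> J = {}"
    and "searchable d n (bisection_cost k (card I)) (slice p (I \<times> A))"
    and "searchable d n (bisection_cost k (card J)) (slice p (J \<times> B))"
  shows "searchable d n (bisection_cost (Suc k) (card Y) - (1 + log 2 (1 + real (card Y))))
    (slice p (I \<times> A \<union> J \<times> B))"
proof -
  have "finite I" "finite J"
    using assms(1-3) by (auto intro: finite_subset)
  then have "card I + card J = card (I \<union> J)"
    using assms(4) by (simp add: card_Un_disjoint)
  also have "\<dots> \<le> card Y"
    using assms(1-3) by (intro card_mono) auto
  finally have "bisection_cost k (card I) + bisection_cost k (card J)
      \<le> bisection_cost (Suc k) (card Y) - (1 + log 2 (1 + real (card Y)))"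
    using bisection_cost_split[of "card I" "card J" "card Y" k] by simp
  then show ?thesis
    unfolding slice_Un by (rule searchable_mono[OF searchable_Un[OF assms(5,6)] order_refl])
qed

lemma searchable_rectangle:
  assumes "finite Y" "finite X" "slice p (Y \<times> X) \<subseteq> grid d n" "card X < 2 ^ k"
  shows "searchable d n (bisection_cost k (card Y)) (slice p (Y \<times> X))"
  using assms
proof (induction k arbitrary: X Y)
  case 0
  then show ?case
    by (auto simp: slice_empty intro: searchable.empty bisection_cost_nonneg)
next
  case (Suc k)
  show ?case
  proof (cases "X = {}")
    case True
    then show ?thesis
      by (auto simp: slice_empty intro: searchable.empty bisection_cost_nonneg)
  next
    case False
    obtain x where median: "x \<in> X" "card (X \<inter> {..<x}) \<le> card X div 2" "card (X \<inter> {x<..}) \<le> card X div 2"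
      using ex_median[OF \<open>finite X\<close> False] .
    define A B where "A = X \<inter> {..<x}" and "B = X \<inter> {x<..}"
    define c where "c = bisection_cost (Suc k) (card Y) - (1 + log 2 (1 + real (card Y)))"
    have sub_rectangle: "searchable d n (bisection_cost k (card I)) (slice p (I \<times> X'))"
      if "I \<subseteq> Y" "X' \<subseteq> X" "card X' < 2 ^ k" for I X'
      using that Suc.prems
      by (intro Suc.IH order_trans[OF slice_mono Suc.prems(3)]) (auto intro: finite_subset)
    have "card A < 2 ^ k" "card B < 2 ^ k"
      using median Suc.prems(4) by (auto simp: A_def B_def)
    then have "searchable d n c (slice p (I \<times> A \<union> J \<times> B))"
      if "I \<subseteq> Y" "J \<subseteq> Y" "I \<inter> J = {}" for I J
      unfolding c_def using that \<open>finite Y\<close>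
      by (intro searchable_disjoint_rows sub_rectangle) (auto simp: A_def B_def)
    then have "searchable d n (floorlog 2 (card Y) + c) (slice p (column_region x A B Y Y))"
      using median(1) \<open>finite Y\<close>
      by (intro searchable_column[of Y] order_trans[OF slice_mono Suc.prems(3)])
        (auto simp: A_def B_def floorlog_leD)
    moreover have "Y \<times> X \<subseteq> column_region x A B Y Y"
      by (auto simp: column_region_def A_def B_def)
    moreover have "floorlog 2 (card Y) + c \<le> bisection_cost (Suc k) (card Y)"
      unfolding c_def using floorlog_le_log_one_plus[of 2 "card Y"] by simp
    ultimately show ?thesis
      by (rule searchable_mono[OF _ slice_mono])
  qed
qed

lemma qc_le_bisection_cost:
  assumes "2 \<le> d" "grid d n \<noteq> {}" "n 2 < 2 ^ k"
  shows "real (qc d n) \<le> (\<Prod>i = 3..d. real (n i)) * bisection_cost k (n 1)"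
proof -
  let ?P = "\<Pi>\<^sub>E i\<in>{3..d}. {0..<n i}" and ?R = "{..<n 1} \<times> {..<n 2}"
  note grid_eq = grid_eq_UN_slice[OF assms(1), of n]
  have "searchable d n (bisection_cost k (n 1)) (slice p ?R)" if "p \<in> ?P" for p
    using searchable_rectangle[of "{..<n 1}" "{..<n 2}" p d n k] that assms(3) unfolding grid_eq by auto
  then have "searchable d n (\<Sum>p\<in>?P. bisection_cost k (n 1)) (grid d n)"
    unfolding grid_eq by (intro searchable_UN finite_PiE) auto
  from qc_le_of_searchable[OF this assms(2)] show ?thesis
    by (simp add: card_PiE)
qed

lemma bisection_cost_floorlog_le:
  assumes "1 \<le> w" "w \<le> h"
  shows "bisection_cost (floorlog 2 w) h \<le> 8 * (real w * (log 2 (real h / real w) + 1))"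
proof -
  define k g where "k = floorlog 2 w" and "g = log 2 (real h / real w)"
  have "0 \<le> g" using assms by (simp add: g_def)
  have "2 ^ (k - 1) \<le> w" "w < 2 ^ k" "0 < k"
    using floorlog_bounds[of w 2] assms(1) by (auto simp: k_def floorlog_def)
  then have "2 ^ k \<le> 2 * w" "w \<le> 2 ^ k"
    by (cases k; simp)+
  then have power_bounds: "2 ^ k \<le> 2 * real w" "real w \<le> 2 ^ k"
    by (metis of_nat_le_iff of_nat_numeral of_nat_power of_nat_mult)+
  have "log 2 (1 + h / 2 ^ k) \<le> log 2 (2 * (real h / real w))"
  proof (rule log_mono)
    have "h / 2 ^ k \<le> real h / real w"
      using power_bounds assms by (intro divide_left_mono) auto
    moreover have "1 \<le> real h / real w" using assms by simp
    ultimately show "1 + h / 2 ^ k \<le> 2 * (real h / real w)" by linarith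
  qed (auto intro: add_pos_nonneg)
  also have "\<dots> = 1 + g"
    unfolding g_def using assms by (subst log_mult) auto
  finally have "(2 ^ k - 1) * (3 + log 2 (1 + h / 2 ^ k)) \<le> 2 ^ k * (4 + g)"
    using \<open>0 \<le> g\<close> by (intro mult_mono) (auto simp: log_one_plus_nonneg)
  then have "bisection_cost k h \<le> 2 ^ k * (4 + g)"
    by (simp add: bisection_cost_def)
  also have "\<dots> \<le> (2 * real w) * (4 * (g + 1))"
    using power_bounds(1) \<open>0 \<le> g\<close> by (intro mult_mono) auto
  finally show ?thesis by (simp add: k_def g_def algebra_simps)
qed

theorem theorem4:
  "(\<lambda>(d, n). real (qc d n))
     \<in> O[principal {(d, n). d \<ge> 2 \<and> antimono_on {1..d} n \<and> n d \<ge> 1}](\<lambda>(d, n).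
         (\<Prod>i = 2..d. real (n i)) * (log 2 (real (n 1) / real (n 2)) + 1))"
proof (rule bigoI[of _ 8], unfold eventually_principal, clarify)
  fix d :: nat and n :: "nat \<Rightarrow> nat"
  let ?f = "log 2 (real (n 1) / real (n 2)) + 1"
  assume d: "2 \<le> d" and anti: "antimono_on {1..d} n" and "1 \<le> n d"
  then have n_pos: "1 \<le> n i" if "i \<in> {1..d}" for i
    using monotone_onD[OF anti that, of d] that by auto
  have "1 \<le> n 2" "n 2 \<le> n 1"
    using monotone_onD[OF anti, of 1 2] n_pos[of 2] d by auto
  have "grid d n \<noteq> {}"
    unfolding grid_def PiE_eq_empty_iff using n_pos by force
  then have "real (qc d n) \<le> (\<Prod>i = 3..d. real (n i)) * bisection_cost (floorlog 2 (n 2)) (n 1)"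
    by (intro qc_le_bisection_cost[OF d]) (auto intro: floorlog_leD)
  also have "\<dots> \<le> (\<Prod>i = 3..d. real (n i)) * (8 * (real (n 2) * ?f))"
    using bisection_cost_floorlog_le[OF \<open>1 \<le> n 2\<close> \<open>n 2 \<le> n 1\<close>]
    by (intro mult_left_mono prod_nonneg) auto
  also have "\<dots> = 8 * ((\<Prod>i = 2..d. real (n i)) * ?f)"
    using d by (simp add: prod.atLeast_Suc_atMost numeral_3_eq_3 numeral_2_eq_2)
  finally show "norm (real (qc d n)) \<le> 8 * norm ((\<Prod>i = 2..d. real (n i)) * ?f)"
    unfolding real_norm_def by linarith
qed

end
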